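(* For all $n\ge1$, the parity-constrained Hanoi graph $P^n$ contains a Hamiltonian cycle.
   Context: Let $Q=\{0,1,2,3\}$ (pegs: $0,3$ neutral; $1$ reserved for even discs; $2$ reserved for odd discs). For a disc $d\in\{1,\dots,n\}$ let $p(d)=1$ if $d$ is even and $p(d)=2$ if $d$ is odd, and $Q^d=\{0,p(d),3\}$. The vertices of $P^n$ are words $s=s_n\cdots s_1\in Q^n$ ($s_d$ is the peg of disc $d$) with $s_d\in Q^d$ for all $d$. Two vertices are adjacent iff they differ in exactly one coordinate $d$, with values $i\ne j$ there, $i,j\in Q^d$, and $s_k\notin\{i,j\}$ for all $k<d$. *)

theory Defs
  imports "Graph_Theory.Graph_Theory"
begin

definition special_peg :: "nat \<Rightarrow> nat" where
  "special_peg d = (if even d then 1 else 2)"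

definition pegs :: "nat \<Rightarrow> nat set" where
  "pegs d = {0, special_peg d, 3}"

text \<open>
  The word \<open>s\<^sub>n \<cdots> s\<^sub>1\<close> is represented by the function \<open>d \<mapsto> s\<^sub>d\<close> on \<open>{1..n}\<close> (with the
  default value \<^term>\<open>undefined\<close> elsewhere, so that words correspond to functions one to one).
\<close>

definition ph_words :: "nat \<Rightarrow> (nat \<Rightarrow> nat) set" where
  "ph_words n = PiE {1..n} pegs"

definition ph_adj :: "nat \<Rightarrow> (nat \<Rightarrow> nat) \<Rightarrow> (nat \<Rightarrow> nat) \<Rightarrow> bool" where
  "ph_adj n s t \<longleftrightarrow> (\<exists>d\<in>{1..n}.
     s d \<noteq> t d \<and>
     (\<forall>k\<in>{1..n}. k \<noteq> d \<longrightarrow> s k = t k) \<and>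
     (\<forall>k\<in>{1..<d}. s k \<notin> {s d, t d}))"

text \<open>The undirected graph \<open>P\<^sup>n\<close>, each edge being a pair of opposite arcs.\<close>

definition parity_hanoi :: "nat \<Rightarrow> (nat \<Rightarrow> nat) pair_pre_digraph" where
  "parity_hanoi n =
     \<lparr> pverts = ph_words n,
       parcs = {(s, t). s \<in> ph_words n \<and> t \<in> ph_words n \<and> ph_adj n s t} \<rparr>"

text \<open>
  The library's \<open>cycle\<close> admits closed walks of length 1 and 2. In a simple undirected graph a cycle
  has length at least 3; in particular traversing one edge back and forth is not a cycle.
  The vertices visited by a nonempty closed walk are the tails of its arcs.
\<close>

definition hamiltonian_cycle :: "('a, 'b) pre_digraph \<Rightarrow> 'b awalk \<Rightarrow> bool" where
  "hamiltonian_cycle G p \<longleftrightarrow>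
     pre_digraph.cycle G p \<and> 3 \<le> length p \<and> tail G ` set p = verts G"

text \<open>Well-formedness: \<open>P\<^sup>n\<close> is a finite simple undirected graph.\<close>

lemma pair_graph_parity_hanoi: "pair_graph (parity_hanoi n)"
proof
  have fin: "finite (ph_words n)"
    by (auto simp: ph_words_def pegs_def intro!: finite_PiE)
  then show "finite (pverts (parity_hanoi n))"
    by (simp add: parity_hanoi_def)
  have "parcs (parity_hanoi n) \<subseteq> ph_words n \<times> ph_words n"
    by (auto simp: parity_hanoi_def)
  with fin show "finite (parcs (parity_hanoi n))"
    by (meson finite_SigmaI finite_subset)
  have sym: "ph_adj n t s" if "ph_adj n s t" for s t
  proof -
    from that obtain d where d: "d \<in> {1..n}" "s d \<noteq> t d"
        "\<forall>k\<in>{1..n}. k \<noteq> d \<longrightarrow> s k = t k" "\<forall>k\<in>{1..<d}. s k \<notin> {s d, t d}"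
      unfolding ph_adj_def by blast
    then have "\<forall>k\<in>{1..<d}. t k \<notin> {t d, s d}" by auto
    with d show ?thesis unfolding ph_adj_def by metis
  qed
  then show "symmetric (with_proj (parity_hanoi n))"
    by (auto simp: symmetric_def sym_def parity_hanoi_def)
qed (auto simp: parity_hanoi_def ph_adj_def)

end

theory Submission
  imports Defs
begin

text \<open>
  Split the vertices of \<open>P\<^bsup>n+1\<^esup>\<close> by the peg of the largest disc into three copies of \<open>P\<^sup>n\<close>.
  The copies of \<open>0\<close> and \<open>3\<close> are joined at the word \<open>q\<close> with every disc on its special peg, those of
  the special peg and \<open>0\<close> are joined at the constant word \<open>3\<close>, those of the special peg and \<open>3\<close> at the
  constant word \<open>0\<close>. So if \<open>P\<^sup>n\<close> has Hamiltonian paths from \<open>0\<close> to \<open>3\<close>, from \<open>q\<close> to \<open>0\<close> and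
  from \<open>q\<close> to \<open>3\<close>, traversing the three copies in a suitable order gives paths of the same three
  kinds in \<open>P\<^bsup>n+1\<^esup>\<close>, and also a closed one: \<open>q \<rightarrow> 3\<close> in copy \<open>0\<close>, \<open>3 \<rightarrow> 0\<close> in the special copy,
  \<open>0 \<rightarrow> q\<close> in copy \<open>3\<close>, and back to the start.
\<close>

definition const_word :: "nat \<Rightarrow> nat \<Rightarrow> nat \<Rightarrow> nat" where
  "const_word n i = (\<lambda>d\<in>{1..n}. i)"

definition special_word :: "nat \<Rightarrow> nat \<Rightarrow> nat" where
  "special_word n = (\<lambda>d\<in>{1..n}. special_peg d)"

definition ham_path :: "nat \<Rightarrow> (nat \<Rightarrow> nat) \<Rightarrow> (nat \<Rightarrow> nat) list \<Rightarrow> (nat \<Rightarrow> nat) \<Rightarrow> bool" where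
  "ham_path n s xs t \<longleftrightarrow>
     xs \<noteq> [] \<and> hd xs = s \<and> last xs = t \<and> distinct xs \<and> set xs = ph_words n \<and>
     successively (ph_adj n) xs"

lemma const_word_Suc: "(const_word n i)(Suc n := i) = const_word (Suc n) i"
  by (auto simp: const_word_def fun_eq_iff)

lemma special_word_Suc:
  "(special_word n)(Suc n := special_peg (Suc n)) = special_word (Suc n)"
  by (auto simp: special_word_def fun_eq_iff)

lemma special_peg_neq: "special_peg d \<noteq> 0" "special_peg d \<noteq> 3"
  by (auto simp: special_peg_def)

lemma ph_adj_sym: "ph_adj n s t \<Longrightarrow> ph_adj n t s"
proof -
  assume "ph_adj n s t"
  then obtain d where d: "d \<in> {1..n}" "s d \<noteq> t d" "\<forall>k\<in>{1..n}. k \<noteq> d \<longrightarrow> s k = t k"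
      "\<forall>k\<in>{1..<d}. s k \<notin> {s d, t d}"
    unfolding ph_adj_def by blast
  then have "\<forall>k\<in>{1..<d}. t k \<notin> {t d, s d}" by auto
  with d show ?thesis unfolding ph_adj_def by metis
qed

text \<open>Only smaller discs block a move, so a larger disc at rest never interferes.\<close>

lemma ph_adj_Suc: "ph_adj n s t \<Longrightarrow> ph_adj (Suc n) (s(Suc n := a)) (t(Suc n := a))"
  unfolding ph_adj_def by (elim bexE, rule_tac x=d in bexI) auto

lemma ph_adj_largest:
  assumes "a \<noteq> b" "\<forall>k\<in>{1..n}. s k \<notin> {a, b}"
  shows "ph_adj (Suc n) (s(Suc n := a)) (s(Suc n := b))"
  unfolding ph_adj_def using assms by (intro bexI[of _ "Suc n"]) auto

text \<open>Words take the default value at \<open>Suc n\<close>, so overwriting that position loses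
  nothing.\<close>

lemma inj_on_upd: "inj_on (\<lambda>s. s(Suc n := a)) (ph_words n)"
proof (rule inj_onI)
  fix s t assume "s \<in> ph_words n" "t \<in> ph_words n" and eq: "s(Suc n := a) = t(Suc n := a)"
  then have "s (Suc n) = t (Suc n)"
    by (metis PiE_arb ph_words_def Suc_n_not_le_n atLeastAtMost_iff)
  with eq show "s = t"
    by (metis fun_upd_triv fun_upd_upd)
qed

text \<open>The pegs may be named in any order, since the paths below visit the copies in different
  orders.\<close>

lemma ph_words_Suc:
  assumes "{a, b, c} = pegs (Suc n)"
  shows "ph_words (Suc n) =
    (\<lambda>s. s(Suc n := a)) ` ph_words n \<union> (\<lambda>s. s(Suc n := b)) ` ph_words n \<union>
    (\<lambda>s. s(Suc n := c)) ` ph_words n"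
proof -
  have "{1..Suc n} = insert (Suc n) {1..n}" by auto
  then show ?thesis
    unfolding ph_words_def by (auto simp: PiE_insert_eq simp flip: assms)
qed

lemma ham_path_rev:
  assumes "ham_path n s xs t"
  shows "ham_path n t (rev xs) s"
  using assms
  by (auto simp: ham_path_def hd_rev last_rev ph_adj_sym elim!: successively_mono)

text \<open>At \<open>u\<close> no smaller disc occupies \<open>a\<close> or \<open>b\<close>, so
  the largest disc can move between them; likewise at \<open>v\<close> for \<open>b\<close> and
  \<open>c\<close>.\<close>

lemma ham_path_glue:
  assumes xs: "ham_path n s xs u" and ys: "ham_path n u ys v" and zs: "ham_path n v zs t"
    and pegs: "{a, b, c} = pegs (Suc n)" and neq: "a \<noteq> b" "b \<noteq> c" "a \<noteq> c"
    and u: "\<forall>k\<in>{1..n}. u k \<notin> {a, b}" and v: "\<forall>k\<in>{1..n}. v k \<notin> {b, c}"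
  shows "ham_path (Suc n) (s(Suc n := a))
    (map (\<lambda>s. s(Suc n := a)) xs @ map (\<lambda>s. s(Suc n := b)) ys @ map (\<lambda>s. s(Suc n := c)) zs)
    (t(Suc n := c))"
proof -
  have lift: "successively (ph_adj (Suc n)) (map (\<lambda>s. s(Suc n := d)) ws)"
    if "ham_path n w ws w'" for d w ws w'
    using that unfolding ham_path_def successively_map
    by (auto elim!: successively_mono intro: ph_adj_Suc)
  have disj: "(\<lambda>s. s(Suc n := d)) ` A \<inter> (\<lambda>s. s(Suc n := e)) ` A = {}"
    if "d \<noteq> e" for d e and A :: "(nat \<Rightarrow> nat) set"
    using that by (auto dest: fun_upd_eqD)
  show ?thesis
    using assms lift[OF xs] lift[OF ys] lift[OF zs] ph_adj_largest[OF neq(1) u]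
      ph_adj_largest[OF neq(2) v]
    by (simp add: ham_path_def successively_append_iff hd_map last_map distinct_map inj_on_upd
        disj ph_words_Suc[OF pegs] Int_Un_distrib Un_assoc)
qed

lemma ham_path_0_3: "\<exists>xs. ham_path n (const_word n 0) xs (const_word n 3)"
proof (induction n)
  case 0
  \<comment> \<open>With no discs there is a single word, so both ends coincide.\<close>
  have "ham_path 0 (const_word 0 0) [const_word 0 0] (const_word 0 3)"
    by (auto simp: ham_path_def const_word_def ph_words_def)
  then show ?case by blast
next
  case (Suc n)
  then obtain xs where xs: "ham_path n (const_word n 0) xs (const_word n 3)" by blast
  have "\<exists>ys. ham_path (Suc n) ((const_word n 0)(Suc n := 0)) ys ((const_word n 3)(Suc n := 3))"
  \<comment> \<open>The special copy comes second and is traversed backwards, from the constant word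
    \<open>3\<close> to the constant word \<open>0\<close>.\<close>
  proof (rule exI, rule ham_path_glue[OF xs ham_path_rev[OF xs] xs])
    show "{0, special_peg (Suc n), 3} = pegs (Suc n)"
      by (simp add: pegs_def)
  qed (use special_peg_neq[of "Suc n"] in \<open>auto simp: const_word_def\<close>)
  then show ?case
    by (simp add: const_word_Suc)
qed

lemma ham_path_special:
  assumes "e \<in> {0, 3}"
  shows "\<exists>xs. ham_path n (special_word n) xs (const_word n e)"
proof (induction n)
  case 0
  have "ham_path 0 (special_word 0) [special_word 0] (const_word 0 e)"
    by (auto simp: ham_path_def const_word_def special_word_def ph_words_def)
  then show ?case by blast
next
  case (Suc n)
  then obtain xs where xs: "ham_path n (special_word n) xs (const_word n e)" by blast
  have "\<exists>ys. ham_path (Suc n) ((special_word n)(Suc n := special_peg (Suc n))) ys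
      ((const_word n e)(Suc n := e))"
  \<comment> \<open>\<open>3 - e\<close> is the other neutral peg. The largest disc leaves its
    special peg at the constant word \<open>e\<close> and goes from \<open>3 - e\<close> to
    \<open>e\<close> at the special word.\<close>
  proof (rule exI, rule ham_path_glue[OF xs ham_path_rev[OF xs] xs, where b = "3 - e"])
    show "{special_peg (Suc n), 3 - e, e} = pegs (Suc n)"
      using assms by (auto simp: pegs_def)
  qed (use assms special_peg_neq in \<open>auto simp: const_word_def special_word_def special_peg_def\<close>)
  then show ?case
    by (simp add: const_word_Suc special_word_Suc)
qed

lemma successively_iff_vwalk_arcs: "successively P xs \<longleftrightarrow> (\<forall>(s, t)\<in>set (vwalk_arcs xs). P s t)"
  by (induction xs rule: vwalk_arcs.induct) auto

lemma map_fst_vwalk_arcs: "map fst (vwalk_arcs (xs @ [y])) = xs"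
  by (induction xs) (auto simp: hd_append neq_Nil_conv)

lemma cas_vwalk_arcs: "pre_digraph.cas (with_proj G) u (vwalk_arcs (u # xs)) (last (u # xs))"
  by (induction xs arbitrary: u) (auto simp: pre_digraph.cas.simps)

lemma hamiltonian_cycle_vwalk_arcs:
  assumes len: "3 \<le> length xs" and dist: "distinct xs" and set: "set xs = pverts G"
    and arcs: "set (vwalk_arcs (xs @ [hd xs])) \<subseteq> parcs G"
  shows "hamiltonian_cycle (with_proj G) (vwalk_arcs (xs @ [hd xs]))"
proof -
  let ?p = "vwalk_arcs (xs @ [hd xs])"
  obtain u ys where xs: "xs = u # ys" using len by (cases xs) auto
  have fst: "map fst ?p = xs" by (rule map_fst_vwalk_arcs)
  then have nonempty: "?p \<noteq> []" using xs by auto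
  have cas: "pre_digraph.cas (with_proj G) u ?p u"
    using cas_vwalk_arcs[of G u "ys @ [u]"] by (simp add: xs)
  \<comment> \<open>Once the last vertex is known to be \<open>u\<close>, the tail of this list is a
    rotation of \<open>xs\<close>, hence distinct as \<open>cycle\<close> requires.\<close>
  have verts: "pre_digraph.awalk_verts (with_proj G) u ?p = xs @ [snd (last ?p)]"
    using nonempty fst by (simp add: pre_digraph.awalk_verts_conv)
  have "snd (last ?p) = u"
    using vwalk_arcs_append[of xs "[u]"] by (simp add: xs del: vwalk_arcs_Cons)
  then have "pre_digraph.cycle (with_proj G) ?p"
    unfolding pre_digraph.cycle_def pre_digraph.awalk_def
    using cas verts nonempty xs dist set arcs by auto
  moreover have "length ?p = length xs" "fst ` set ?p = set xs"
    using fst by (metis length_map, metis set_map)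
  ultimately show ?thesis
    using len set by (simp add: hamiltonian_cycle_def)
qed

theorem theorem6p21:
  fixes n :: nat
  assumes "n \<ge> 1"
  shows "\<exists>p. hamiltonian_cycle (with_proj (parity_hanoi n)) p"
proof -
  obtain m where n: "n = Suc m" using assms by (cases n) auto
  define q where "q = special_word m"
  obtain xs where xs: "ham_path m q xs (const_word m 3)"
    using ham_path_special[of 3 m] unfolding q_def by auto
  obtain ys where ys: "ham_path m (const_word m 3) ys (const_word m 0)"
    using ham_path_0_3 ham_path_rev by blast
  obtain zs where zs: "ham_path m (const_word m 0) zs q"
    using ham_path_special[of 0 m] ham_path_rev unfolding q_def by blast
  define ws where "ws = map (\<lambda>s. s(n := 0)) xs @ map (\<lambda>s. s(n := special_peg n)) ys
    @ map (\<lambda>s. s(n := 3)) zs"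
  have ws: "ham_path n (q(n := 0)) ws (q(n := 3))"
    unfolding ws_def n
    by (rule ham_path_glue[OF xs ys zs])
      (use special_peg_neq[of "Suc m"] in \<open>auto simp: pegs_def const_word_def\<close>)
  \<comment> \<open>The closing edge: at \<open>q\<close> all smaller discs avoid both neutral
    pegs.\<close>
  have "ph_adj n (q(n := 0)) (q(n := 3))"
    unfolding n by (rule ph_adj_largest) (auto simp: q_def special_word_def special_peg_neq)
  then have closed: "successively (ph_adj n) (ws @ [hd ws])"
    using ws by (simp add: ham_path_def successively_append_iff ph_adj_sym)
  \<comment> \<open>Each copy contributes a vertex; for \<open>m = 0\<close> exactly one, and the
    cycle is a triangle.\<close>
  have "1 \<le> length xs" "1 \<le> length ys" "1 \<le> length zs"
    using xs ys zs by (auto simp: ham_path_def Suc_le_eq)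
  then have len: "3 \<le> length ws"
    unfolding ws_def length_append length_map by linarith
  \<comment> \<open>The repeated head adds no new vertex, so both ends of every arc are
    words.\<close>
  have words: "set (ws @ [hd ws]) = ph_words n"
    using ws unfolding ham_path_def
    by (metis Un_insert_right hd_in_set insert_absorb list.set(1,2) set_append sup_bot_right)
  have arcs: "set (vwalk_arcs (ws @ [hd ws])) \<subseteq> parcs (parity_hanoi n)"
  proof safe
    fix s t assume st: "(s, t) \<in> set (vwalk_arcs (ws @ [hd ws]))"
    then have "s \<in> set (ws @ [hd ws])" "t \<in> set (ws @ [hd ws])"
      by (blast elim: in_set_vwalk_arcsE)+
    then have "s \<in> ph_words n" "t \<in> ph_words n"
      unfolding words .
    with st closed show "(s, t) \<in> parcs (parity_hanoi n)"
      by (auto simp: parity_hanoi_def successively_iff_vwalk_arcs)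
  qed
  have "hamiltonian_cycle (with_proj (parity_hanoi n)) (vwalk_arcs (ws @ [hd ws]))"
  proof (rule hamiltonian_cycle_vwalk_arcs[OF len _ _ arcs])
    show "distinct ws" "set ws = pverts (parity_hanoi n)"
      using ws by (simp_all add: ham_path_def parity_hanoi_def)
  qed
  then show ?thesis by blast
qed

end
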